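(* Consider the multiple-choice knapsack problem $(MCKP)$: maximize $p^{T}x$ subject to $x\in F=\{x\in X : c^{T}x\le b\}$, and suppose that $C_{min}\le b$ and that $b<c^{T}x_{p}\le C_{max}$ for every $x_{p}\in X$ with $p^{T}x_{p}=P_{max}$. Let $S_{bo}$ be the set of all Pareto solutions of the bi-objective problem $(BP)$ of maximizing $(p^{T}x,-c^{T}x)$ over $x\in X$. Let $x^{*}\in S_{bo}$ be such that $$b-c^{T}x^{*}=\min\{\,b-c^{T}x \;:\; x\in S_{bo},\ b-c^{T}x\ge 0\,\}.$$ Then $x^{*}$ solves $(MCKP)$, i.e., $x^{*}\in F$ and $p^{T}x^{*}=\max_{x\in F}p^{T}x$.
   Context: Let $k\ge 1$ and $n_{1},\dots,n_{k}\ge 1$ be integers, $n=\sum_{i=1}^{k}n_{i}$. Vectors $x\in\mathbb{R}^{n}$ are indexed as $x=(x_{ij})$, $i=1,\dots,k$, $j=1,\dots,n_{i}$. The vectors $p=(p_{ij})\in\mathbb{R}^{n}$ (profits) and $c=(c_{ij})\in\mathbb{R}^{n}$ (costs) have real nonnegative entries, and $b\ge 0$ is a real number. $u^{T}v$ denotes the usual scalar product. $X:=\{(x_{ij}) : \sum_{j=1}^{n_{i}}x_{ij}=1,\ x_{ij}\in\{0,1\},\ i=1,\dots,k,\ j=1,\dots,n_{i}\}$. $C_{min}:=\min_{x\in X}c^{T}x$, $C_{max}:=\max_{x\in X}c^{T}x$, $P_{max}:=\max_{x\in X}p^{T}x$. A point $x\in X$ is a Pareto solution (Pareto efficient solution)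 of $(BP)$ if there is no $\bar{x}\in X$ with $p^{T}\bar{x}\ge p^{T}x$ and $-c^{T}\bar{x}\ge -c^{T}x$ and at least one of these two inequalities strict. *)

theory Defs
  imports "HOL-Analysis.Analysis"
begin

text \<open>
  A vector of \<open>\<real>\<^sup>n\<close> with \<open>n = n\<^sub>1 + \<dots> + n\<^sub>k\<close> is a function on the index pairs \<open>(i, j)\<close>;
  the argument \<open>n\<close> below is the family of class sizes \<open>n\<^sub>1, \<dots>, n\<^sub>k\<close>, not their sum.
  Only the values on \<open>mc_index k n\<close> are meaningful.
\<close>

definition mc_index :: "nat \<Rightarrow> (nat \<Rightarrow> nat) \<Rightarrow> (nat \<times> nat) set" where
  "mc_index k n = (SIGMA i:{1..k}. {1..n i})"

definition scalar_prod ::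
    "nat \<Rightarrow> (nat \<Rightarrow> nat) \<Rightarrow> (nat \<times> nat \<Rightarrow> real) \<Rightarrow> (nat \<times> nat \<Rightarrow> real) \<Rightarrow> real" where
  "scalar_prod k n u v = (\<Sum>ij\<in>mc_index k n. u ij * v ij)"

text \<open>
  The extensional function space pins down the values outside the index set, so that each
  point of \<open>X\<close> is represented by exactly one function; in particular \<open>X\<close> is finite and
  \<open>Min\<close> and \<open>Max\<close> over its images are genuine minima and maxima.
\<close>

definition mc_X :: "nat \<Rightarrow> (nat \<Rightarrow> nat) \<Rightarrow> (nat \<times> nat \<Rightarrow> real) set" where
  "mc_X k n = {x \<in> mc_index k n \<rightarrow>\<^sub>E {0, 1}. \<forall>i\<in>{1..k}. (\<Sum>j=1..n i. x (i, j)) = 1}"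

definition C_min :: "nat \<Rightarrow> (nat \<Rightarrow> nat) \<Rightarrow> (nat \<times> nat \<Rightarrow> real) \<Rightarrow> real" where
  "C_min k n c = Min (scalar_prod k n c ` mc_X k n)"

definition C_max :: "nat \<Rightarrow> (nat \<Rightarrow> nat) \<Rightarrow> (nat \<times> nat \<Rightarrow> real) \<Rightarrow> real" where
  "C_max k n c = Max (scalar_prod k n c ` mc_X k n)"

definition P_max :: "nat \<Rightarrow> (nat \<Rightarrow> nat) \<Rightarrow> (nat \<times> nat \<Rightarrow> real) \<Rightarrow> real" where
  "P_max k n p = Max (scalar_prod k n p ` mc_X k n)"

definition mckp_feasible ::
    "nat \<Rightarrow> (nat \<Rightarrow> nat) \<Rightarrow> (nat \<times> nat \<Rightarrow> real) \<Rightarrow> real \<Rightarrow> (nat \<times> nat \<Rightarrow> real) set" where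
  "mckp_feasible k n c b = {x \<in> mc_X k n. scalar_prod k n c x \<le> b}"

definition pareto_solutions :: "'a set \<Rightarrow> ('a \<Rightarrow> real) \<Rightarrow> ('a \<Rightarrow> real) \<Rightarrow> 'a set" where
  "pareto_solutions A f g =
    {x \<in> A. \<not> (\<exists>y\<in>A. f y \<ge> f x \<and> g y \<ge> g x \<and> (f y > f x \<or> g y > g x))}"

definition S_bo ::
    "nat \<Rightarrow> (nat \<Rightarrow> nat) \<Rightarrow> (nat \<times> nat \<Rightarrow> real) \<Rightarrow> (nat \<times> nat \<Rightarrow> real) \<Rightarrow> (nat \<times> nat \<Rightarrow> real) set" where
  "S_bo k n p c =
    pareto_solutions (mc_X k n) (scalar_prod k n p) (\<lambda>x. - scalar_prod k n c x)"

end

theory Submission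
  imports Defs
begin

text \<open>
  Every feasible point is dominated by an efficient one, which is then feasible too. If a feasible
  point had larger profit than \<open>x\<^sup>*\<close>, so would an efficient feasible \<open>z\<close> dominating it; but \<open>x\<^sup>*\<close> has
  the least slack among the efficient feasible points, so \<open>z\<close> costs no more than \<open>x\<^sup>*\<close>, and \<open>x\<^sup>*\<close>
  would be dominated by \<open>z\<close>.
\<close>

text \<open>Scalarization: among the finitely many points at least as good as \<open>x\<close> in
  both objectives, take one with the largest \<open>f + g\<close>. An improvement in one objective
  without loss in the other would increase this sum.\<close>

lemma ex_pareto_dominating:
  assumes "finite A" and "x \<in> A"
  shows "\<exists>y\<in>pareto_solutions A f g. f x \<le> f y \<and> g x \<le> g y"
proof -
  define D where "D = {y \<in> A. f x \<le> f y \<and> g x \<le> g y}"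
  have "finite D" "D \<noteq> {}"
    using assms by (auto simp: D_def)
  then obtain y where y: "y \<in> D" and y_Max: "Max ((\<lambda>z. f z + g z) ` D) = f y + g y"
    by (rule obtains_MAX)
  have y_max: "f z + g z \<le> f y + g y" if "z \<in> D" for z
    unfolding y_Max[symmetric] using that \<open>finite D\<close> by (intro Max_ge) auto
  have "y \<in> pareto_solutions A f g"
  proof -
    have "\<not> (f y < f z \<or> g y < g z)" if "z \<in> A" "f y \<le> f z" "g y \<le> g z" for z
    proof -
      \<comment> \<open>Weak dominance is transitive, so \<open>z\<close> is at least as good as
        \<open>x\<close> too and competes for the maximal sum.\<close>
      have "z \<in> D"
        using y that by (auto simp: D_def)
      from y_max[OF this] that show ?thesis
        by linarith
    qed
    then show ?thesis
      using y by (auto simp: D_def pareto_solutions_def)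
  qed
  with y show ?thesis
    by (auto simp: D_def)
qed

lemma pareto_least_slack_optimal:
  fixes A :: "'a set" and f h :: "'a \<Rightarrow> real"
  defines "S \<equiv> pareto_solutions A f (\<lambda>x. - h x)"
  assumes "finite A" and feasible: "{x \<in> A. h x \<le> b} \<noteq> {}"
    and "x \<in> S" and slack: "b - h x = Min {b - h y | y. y \<in> S \<and> b - h y \<ge> 0}"
  shows "x \<in> {x \<in> A. h x \<le> b} \<and> f x = Max (f ` {x \<in> A. h x \<le> b})"
proof -
  let ?T = "{b - h y | y. y \<in> S \<and> b - h y \<ge> 0}"
  have "S \<subseteq> A"
    by (auto simp: S_def pareto_solutions_def)
  then have "finite ?T"
    using \<open>finite A\<close> by (auto intro: finite_subset[of _ "(\<lambda>y. b - h y) ` A"])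
  have dominating: "\<exists>z\<in>S. h z \<le> b \<and> f y \<le> f z" if "y \<in> A" "h y \<le> b" for y
    using ex_pareto_dominating[OF \<open>finite A\<close> \<open>y \<in> A\<close>, of f "\<lambda>x. - h x"] that
    unfolding S_def by (meson neg_le_iff_le order_trans)
  \<comment> \<open>\<open>Min\<close> is unspecified on the empty set, so \<open>slack\<close> says
    something about \<open>x\<close> only once \<open>?T\<close> has an element. Then the minimum is
    attained, and the slack of \<open>x\<close> is nonnegative.\<close>
  obtain z where "z \<in> S" "h z \<le> b"
    using feasible dominating by blast
  then have "b - h z \<in> ?T"
    by auto
  with \<open>finite ?T\<close> have "b - h x \<in> ?T"
    unfolding slack by (intro Min_in) auto
  then have "h x \<le> b"
    by auto
  with \<open>x \<in> S\<close> \<open>S \<subseteq> A\<close> have x: "x \<in> {x \<in> A. h x \<le> b}"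
    by auto
  have "f y \<le> f x" if y: "y \<in> A" "h y \<le> b" for y
  proof (rule ccontr)
    assume "\<not> f y \<le> f x"
    with dominating[OF y] obtain z where z: "z \<in> S" "h z \<le> b" "f x < f z"
      by auto
    then have "b - h z \<in> ?T"
      by auto
    \<comment> \<open>Least slack means greatest cost among the efficient feasible points.\<close>
    with \<open>finite ?T\<close> slack have "h z \<le> h x"
      using Min_le[of ?T "b - h z"] by linarith
    with z \<open>x \<in> S\<close> \<open>S \<subseteq> A\<close> show False
      unfolding S_def pareto_solutions_def by auto
  qed
  then have "f x = Max (f ` {x \<in> A. h x \<le> b})"
    using x \<open>finite A\<close> by (intro Max_eqI[symmetric]) auto
  with x show ?thesis ..
qed

lemma finite_mc_X: "finite (mc_X k n)"
  by (rule finite_subset[of _ "mc_index k n \<rightarrow>\<^sub>E {0, 1}"])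
    (auto simp: mc_X_def mc_index_def intro!: finite_PiE)

lemma mc_X_nonempty:
  assumes "\<And>i. i \<in> {1..k} \<Longrightarrow> n i \<ge> 1"
  shows "mc_X k n \<noteq> {}"
proof -
  \<comment> \<open>Choose the first item of every class; it exists because
    \<open>n i \<ge> 1\<close>. The restriction makes the choice extensional.\<close>
  define x :: "nat \<times> nat \<Rightarrow> real"
    where "x = restrict (\<lambda>(i, j). if j = 1 then 1 else 0) (mc_index k n)"
  have "(\<Sum>j=1..n i. x (i, j)) = 1" if "i \<in> {1..k}" for i
  proof -
    have "(\<Sum>j=1..n i. x (i, j)) = (\<Sum>j=1..n i. if j = 1 then 1 else 0)"
      using that by (intro sum.cong) (auto simp: x_def mc_index_def)
    also have "\<dots> = 1"
      using assms[OF that] by simp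
    finally show ?thesis .
  qed
  moreover have "x \<in> mc_index k n \<rightarrow>\<^sub>E {0, 1}"
    by (auto simp: x_def split: if_splits)
  ultimately show ?thesis
    by (auto simp: mc_X_def)
qed

theorem theorem3p1:
  fixes k :: nat and n :: "nat \<Rightarrow> nat"
    and p c xs :: "nat \<times> nat \<Rightarrow> real" and b :: real
  assumes "k \<ge> 1" and "\<And>i. i \<in> {1..k} \<Longrightarrow> n i \<ge> 1"
    and "\<And>ij. ij \<in> mc_index k n \<Longrightarrow> p ij \<ge> 0"
    and "\<And>ij. ij \<in> mc_index k n \<Longrightarrow> c ij \<ge> 0"
    and "b \<ge> 0"
    and "C_min k n c \<le> b"
    and "\<And>xp. xp \<in> mc_X k n \<Longrightarrow> scalar_prod k n p xp = P_max k n p \<Longrightarrow>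
           b < scalar_prod k n c xp \<and> scalar_prod k n c xp \<le> C_max k n c"
    and "xs \<in> S_bo k n p c"
    and "b - scalar_prod k n c xs =
           Min {b - scalar_prod k n c x | x. x \<in> S_bo k n p c \<and> b - scalar_prod k n c x \<ge> 0}"
  shows "xs \<in> mckp_feasible k n c b \<and>
         scalar_prod k n p xs = Max (scalar_prod k n p ` mckp_feasible k n c b)"
proof -
  \<comment> \<open>The minimum cost is attained, so \<open>C_min k n c \<le> b\<close> yields a
    feasible point, namely a cheapest one.\<close>
  have "C_min k n c \<in> scalar_prod k n c ` mc_X k n"
    unfolding C_min_def using mc_X_nonempty[OF assms(2)] finite_mc_X by (intro Min_in) auto
  with \<open>C_min k n c \<le> b\<close> have "{x \<in> mc_X k n. scalar_prod k n c x \<le> b} \<noteq> {}"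
    by auto
  from pareto_least_slack_optimal[OF finite_mc_X this assms(8,9)[unfolded S_bo_def]]
  show ?thesis
    unfolding mckp_feasible_def .
qed

end
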